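(* Let $\mathbb{F}_q$ be a finite field of characteristic different from $2$ and $3$, let $E\colon y^2=x^3+ax+b$ and $E'\colon y^2=x^3+a'x+b'$ be elliptic curves over $\mathbb{F}_q$, and let $\varphi\colon E\to E'$ be an isogeny defined over $\mathbb{F}_q$ of prime degree $\ell$. Let $u_\varphi,v_\varphi\in\mathbb{F}_q(x)$ be the unique rational functions such that $\varphi(x,y)=\big(u_\varphi(x),\,y\cdot v_\varphi(x)\big)$, and let $K$ be the kernel of $\varphi$. Then the following conditions are equivalent: (i) $u_\varphi$ has no $\mathbb{F}_q$-rational pole; (ii) $K(\mathbb{F}_{q^2})=\{0\}$; (iii) $u_\varphi$ is a permutation rational function of $\mathbb{F}_q$.
   Context: A permutation rational function over $\mathbb{F}_q$ is a rational function $f\in\mathbb{F}_q(x)$ that induces a bijection of $\mathbb{F}_q$ onto itself, i.e. $f$ has no pole in $\mathbb{F}_q$ and for every $y\in\mathbb{F}_q$ there is exactly one $x\in\mathbb{F}_q$ with $f(x)=y$. The rational functions $u_\varphi,v_\varphi$ exist and are unique because $\varphi$ commutes with multiplication by $-1$, so the $x$-coordinate of $\varphi(x,y)$ is even in $y$ and the $y$-coordinate is odd in $y$. $K(\mathbb{F}_{q^2})$ denotes the set of points of $K$ with coordinates in $\mathbb{F}_{q^2}$ (together with the identity $0$). *)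

theory Defs
  imports "HOL-Algebra.Algebraic_Closure_Type" "HOL-Library.Cardinality"
begin

section \<open>Rational functions in one variable\<close>

definition rf_pole :: "'k::field poly fract \<Rightarrow> 'k \<Rightarrow> bool" where
  "rf_pole r c \<longleftrightarrow> \<not> (\<exists>n d. r = Fract n d \<and> poly d c \<noteq> 0)"

text \<open>The value at a point that is not a pole; at a pole it is unspecified.\<close>

definition rf_eval :: "'k::field poly fract \<Rightarrow> 'k \<Rightarrow> 'k" where
  "rf_eval r c = (THE w. \<exists>n d. r = Fract n d \<and> poly d c \<noteq> 0 \<and> w = poly n c / poly d c)"

lemma rf_eval_Fract:
  assumes "poly d c \<noteq> 0"
  shows "rf_eval (Fract n d) c = poly n c / poly d c"
  unfolding rf_eval_def
proof (rule the_equality)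
  fix w assume "\<exists>n' d'. Fract n d = Fract n' d' \<and> poly d' c \<noteq> 0 \<and> w = poly n' c / poly d' c"
  then obtain n' d' where *: "Fract n d = Fract n' d'" "poly d' c \<noteq> 0" "w = poly n' c / poly d' c"
    by blast
  have "d \<noteq> 0" "d' \<noteq> 0" using assms * by auto
  with * have "n * d' = n' * d" by (simp add: eq_fract)
  then have "poly n c * poly d' c = poly n' c * poly d c" by (metis poly_mult)
  with * assms show "w = poly n c / poly d c" by (simp add: frac_eq_eq)
qed (use assms in blast)

definition permutation_rf :: "'k::field poly fract \<Rightarrow> bool" where
  "permutation_rf r \<longleftrightarrow> (\<forall>c. \<not> rf_pole r c) \<and> (\<forall>y. \<exists>!x. rf_eval r x = y)"

lemma map_poly_to_ac_mult:
  fixes p q :: "'a::field poly"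
  shows "map_poly to_ac (p * q) = map_poly to_ac p * map_poly to_ac q"
  by (rule poly_eqI) (simp add: coeff_map_poly coeff_mult to_ac_sum)

text \<open>Base change of a rational function from a field to its algebraic closure.\<close>

definition rf_ac :: "'a::field poly fract \<Rightarrow> 'a alg_closure poly fract" where
  "rf_ac r = (THE w. \<exists>n d. d \<noteq> 0 \<and> r = Fract n d \<and> w = Fract (map_poly to_ac n) (map_poly to_ac d))"

lemma rf_ac_Fract:
  fixes n d :: "'a::field poly"
  assumes "d \<noteq> 0"
  shows "rf_ac (Fract n d) = Fract (map_poly to_ac n) (map_poly to_ac d)"
  unfolding rf_ac_def
proof (rule the_equality)
  fix w assume "\<exists>n' d'. d' \<noteq> 0 \<and> Fract n d = Fract n' d' \<and>
    w = Fract (map_poly to_ac n') (map_poly to_ac d')"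
  then obtain n' d' where *: "d' \<noteq> 0" "Fract n d = Fract n' d'"
    "w = Fract (map_poly to_ac n') (map_poly to_ac d')" by blast
  with assms have "n * d' = n' * d" by (simp add: eq_fract)
  then have "map_poly to_ac n * map_poly to_ac d' = map_poly to_ac n' * map_poly to_ac d"
    by (metis map_poly_to_ac_mult)
  moreover have "map_poly to_ac d \<noteq> 0" "map_poly to_ac d' \<noteq> 0"
    using assms * by (simp_all add: map_poly_eq_0_iff)
  ultimately show "w = Fract (map_poly to_ac n) (map_poly to_ac d)"
    using * by (simp add: eq_fract)
qed (use assms in blast)


section \<open>Curves in short Weierstrass form and their group law\<close>

datatype 'k ec_point = Infinity | Affine 'k 'k

definition elliptic_curve :: "'k::field \<Rightarrow> 'k \<Rightarrow> bool" where
  "elliptic_curve a b \<longleftrightarrow> 4 * a ^ 3 + 27 * b ^ 2 \<noteq> 0"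

definition ec_points :: "'k::field \<Rightarrow> 'k \<Rightarrow> 'k ec_point set" where
  "ec_points a b = insert Infinity {Affine x y |x y. y ^ 2 = x ^ 3 + a * x + b}"

text \<open>The chord-and-tangent law; the coefficient \<open>b\<close> does not enter the formulas.\<close>

fun ec_add :: "'k::field \<Rightarrow> 'k ec_point \<Rightarrow> 'k ec_point \<Rightarrow> 'k ec_point" where
  "ec_add a Infinity Q = Q"
| "ec_add a P Infinity = P"
| "ec_add a (Affine x1 y1) (Affine x2 y2) =
    (if x1 = x2 \<and> y1 = - y2 then Infinity
     else let m = (if x1 = x2 then (3 * x1 ^ 2 + a) / (2 * y1) else (y2 - y1) / (x2 - x1));
              x3 = m ^ 2 - x1 - x2
          in Affine x3 (m * (x1 - x3) - y1))"

text \<open>The geometric points, over the algebraic closure, of the curve with coefficients \<open>a\<close>, \<open>b\<close>.\<close>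

abbreviation geom_points :: "'a::field \<Rightarrow> 'a \<Rightarrow> 'a alg_closure ec_point set" where
  "geom_points a b \<equiv> ec_points (to_ac a) (to_ac b)"


section \<open>Isogenies\<close>

fun proj_coords :: "'k::field ec_point \<Rightarrow> 'k \<times> 'k \<times> 'k" where
  "proj_coords Infinity = (0, 1, 0)"
| "proj_coords (Affine x y) = (x, y, 1)"

text \<open>The value of a homogeneous polynomial of degree \<open>d\<close> in three variables over the base field;
  \<open>c i j\<close> is the coefficient of \<open>x^i y^j z^(d-i-j)\<close>, and only \<open>i + j \<le> d\<close> matters.\<close>

definition hom_eval ::
  "nat \<Rightarrow> (nat \<Rightarrow> nat \<Rightarrow> 'a::field) \<Rightarrow> 'a alg_closure \<times> 'a alg_closure \<times> 'a alg_closure \<Rightarrow> 'a alg_closure"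
where
  "hom_eval d c = (\<lambda>(x, y, z). \<Sum>i\<le>d. \<Sum>j\<le>d - i. to_ac (c i j) * x ^ i * y ^ j * z ^ (d - i - j))"

text \<open>Morphisms of projective curves defined over the base field: every geometric point has a
  neighbourhood on which the map is \<open>[F : G : H]\<close> with homogeneous polynomials \<open>F\<close>, \<open>G\<close>, \<open>H\<close>
  of the same degree with coefficients in the base field.\<close>

definition ec_morphism ::
  "'a::field \<Rightarrow> 'a \<Rightarrow> 'a \<Rightarrow> 'a \<Rightarrow> ('a alg_closure ec_point \<Rightarrow> 'a alg_closure ec_point) \<Rightarrow> bool"
where
  "ec_morphism a b a' b' \<phi> \<longleftrightarrow>
     \<phi> \<in> geom_points a b \<rightarrow> geom_points a' b' \<and>
     (\<forall>P\<in>geom_points a b. \<exists>d cF cG cH.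
        let val = (\<lambda>Q. (hom_eval d cF (proj_coords Q), hom_eval d cG (proj_coords Q),
                         hom_eval d cH (proj_coords Q)))
        in val P \<noteq> (0, 0, 0) \<and>
           (\<forall>Q\<in>geom_points a b. val Q \<noteq> (0, 0, 0) \<longrightarrow>
              (\<exists>t. t \<noteq> 0 \<and> (case proj_coords (\<phi> Q) of (x, y, z) \<Rightarrow> val Q = (t * x, t * y, t * z)))))"

text \<open>An isogeny over the base field is a nonconstant morphism over the base field that is a
  homomorphism on geometric points.\<close>

definition isogeny ::
  "'a::field \<Rightarrow> 'a \<Rightarrow> 'a \<Rightarrow> 'a \<Rightarrow> ('a alg_closure ec_point \<Rightarrow> 'a alg_closure ec_point) \<Rightarrow> bool"
where
  "isogeny a b a' b' \<phi> \<longleftrightarrow>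
     ec_morphism a b a' b' \<phi> \<and>
     (\<forall>P\<in>geom_points a b. \<forall>Q\<in>geom_points a b.
        \<phi> (ec_add (to_ac a) P Q) = ec_add (to_ac a') (\<phi> P) (\<phi> Q)) \<and>
     (\<exists>P\<in>geom_points a b. \<exists>Q\<in>geom_points a b. \<phi> P \<noteq> \<phi> Q)"

definition isogeny_kernel ::
  "'a::field \<Rightarrow> 'a \<Rightarrow> ('a alg_closure ec_point \<Rightarrow> 'a alg_closure ec_point) \<Rightarrow> 'a alg_closure ec_point set"
where
  "isogeny_kernel a b \<phi> = {P \<in> geom_points a b. \<phi> P = Infinity}"

text \<open>The identity \<open>\<phi>(x, y) = (u(x), y v(x))\<close> of rational maps: it holds at all but finitely many
  geometric points.\<close>

definition standard_form ::
  "'a::field \<Rightarrow> 'a \<Rightarrow> ('a alg_closure ec_point \<Rightarrow> 'a alg_closure ec_point) \<Rightarrow>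
   'a poly fract \<Rightarrow> 'a poly fract \<Rightarrow> bool"
where
  "standard_form a b \<phi> u v \<longleftrightarrow>
     finite {P \<in> geom_points a b. \<not> (\<exists>x y. P = Affine x y \<and>
       \<not> rf_pole (rf_ac u) x \<and> \<not> rf_pole (rf_ac v) x \<and>
       \<phi> P = Affine (rf_eval (rf_ac u) x) (y * rf_eval (rf_ac v) x))}"


section \<open>The degree of an isogeny\<close>

text \<open>The function field \<open>k(x)[y] / (y^2 - x^3 - a x - b)\<close>; the pair \<open>(r, s)\<close> stands for
  \<open>r + s y\<close>.\<close>

definition function_field :: "'a::field \<Rightarrow> 'a \<Rightarrow> ('a poly fract \<times> 'a poly fract) ring" where
  "function_field a b =
     \<lparr> carrier = UNIV,
       monoid.mult = (\<lambda>(r, s) (r', s'). (r * r' + s * s' * Fract [:b, a, 0, 1:] 1, r * s' + s * r')),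
       one = (1, 0),
       ring.zero = (0, 0),
       add = (\<lambda>(r, s) (r', s'). (r + r', s + s')) \<rparr>"

definition ff_value ::
  "'a::field poly fract \<times> 'a poly fract \<Rightarrow> 'a alg_closure ec_point \<Rightarrow> 'a alg_closure \<Rightarrow> bool"
where
  "ff_value g P w \<longleftrightarrow> (\<exists>x y. P = Affine x y \<and>
     \<not> rf_pole (rf_ac (fst g)) x \<and> \<not> rf_pole (rf_ac (snd g)) x \<and>
     w = rf_eval (rf_ac (fst g)) x + rf_eval (rf_ac (snd g)) x * y)"

text \<open>The image of the comorphism, which sends a function \<open>h\<close> on the target to the function on the
  source that agrees with \<open>h \<circ> \<phi>\<close> at all but finitely many geometric points.\<close>

definition pullback_field ::
  "'a::field \<Rightarrow> 'a \<Rightarrow> 'a \<Rightarrow> 'a \<Rightarrow> ('a alg_closure ec_point \<Rightarrow> 'a alg_closure ec_point) \<Rightarrow>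
   ('a poly fract \<times> 'a poly fract) set"
where
  "pullback_field a b a' b' \<phi> =
     {g \<in> carrier (function_field a b). \<exists>h \<in> carrier (function_field a' b').
        finite {P \<in> geom_points a b. \<not> (\<exists>w. ff_value g P w \<and> ff_value h (\<phi> P) w)}}"

definition has_isogeny_degree ::
  "'a::field \<Rightarrow> 'a \<Rightarrow> 'a \<Rightarrow> 'a \<Rightarrow> ('a alg_closure ec_point \<Rightarrow> 'a alg_closure ec_point) \<Rightarrow> nat \<Rightarrow> bool"
where
  "has_isogeny_degree a b a' b' \<phi> n \<longleftrightarrow>
     ring.dimension (function_field a b) n (pullback_field a b a' b' \<phi>) (carrier (function_field a b))"


section \<open>The quadratic extension of a finite field\<close>

text \<open>The subfield of order \<open>q^2\<close> of the algebraic closure of a field with \<open>q\<close> elements.\<close>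

definition Fq2 :: "'a::{finite,field} alg_closure set" where
  "Fq2 = {z. z ^ (CARD('a) ^ 2) = z}"

definition Fq2_rational :: "'a::{finite,field} alg_closure ec_point set \<Rightarrow> 'a alg_closure ec_point set"
where
  "Fq2_rational K = {P \<in> K. P = Infinity \<or> (\<exists>x\<in>Fq2. \<exists>y\<in>Fq2. P = Affine x y)}"

end

theory Submission
  imports Defs
begin

text \<open>Let \<open>\<pi>\<close> be the \<open>q\<close>-Frobenius. A point \<open>(c, y)\<close> with \<open>c\<close> in the base field has \<open>y\<close> in \<open>Fq2\<close>; it lies
  in the kernel if and only if \<open>c\<close> is a pole of \<open>u\<close>, and otherwise its image has abscissa \<open>u(c)\<close>.
  If \<open>P\<close> is a nonzero kernel point over \<open>Fq2\<close>, then \<open>P + \<pi> P\<close> is a kernel point fixed by \<open>\<pi>\<close>: either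
  it is nonzero and its abscissa is a rational pole, or \<open>\<pi> P = - P\<close> and the abscissa of \<open>P\<close> is one.
  If \<open>u(c1) = u(c2)\<close>, then points above \<open>c1\<close> and \<open>c2\<close> have equal or opposite images, so their sum or
  difference is a kernel point over \<open>Fq2\<close>; if that kernel is trivial, \<open>c1 = c2\<close>.\<close>

section \<open>The Frobenius endomorphism\<close>

text \<open>Multiplication by a nonzero \<open>x\<close> permutes the nonzero elements, so comparing
  their product before and after gives \<open>x ^ (q - 1) = 1\<close>, where \<open>q\<close> is the
  order of the field.\<close>

lemma finite_field_power_card:
  fixes x :: "'a::{finite,field}"
  shows "x ^ CARD('a) = x"
proof (cases "x = 0")
  case False
  have "(\<Prod>y\<in>UNIV - {0}. y) = (\<Prod>y\<in>UNIV - {0}. x * y)"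
    by (rule prod.reindex_bij_witness[of _ "\<lambda>y. x * y" "\<lambda>y. y / x"]) (use False in auto)
  also have "\<dots> = x ^ card (UNIV - {0::'a}) * (\<Prod>y\<in>UNIV - {0}. y)"
    by (simp add: prod.distrib)
  finally have "x ^ card (UNIV - {0::'a}) = 1"
    by simp
  moreover have "CARD('a) = Suc (card (UNIV - {0::'a}))"
    by (rule card.remove) simp_all
  ultimately show ?thesis
    by (simp only: power_Suc mult_1_right)
qed (simp add: power_0_left)

lemma card_range_to_ac: "card (range (to_ac :: 'a::{finite,field} \<Rightarrow> _)) = CARD('a)"
  by (rule card_image) (rule inj_to_ac)

lemma to_ac_power_card: "to_ac (c :: 'a::{finite,field}) ^ CARD('a) = to_ac c"
  by (metis finite_field_power_card to_ac_power)

text \<open>Additivity in one argument at a time: both sides are monic polynomials of degree \<open>q\<close>, so it is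
  enough that they agree at the \<open>q\<close> elements of the base field.\<close>

lemma power_card_add_aux:
  fixes x z :: "'a::{finite,field} alg_closure"
  assumes "\<And>c::'a. (x + to_ac c) ^ CARD('a) = x ^ CARD('a) + to_ac c"
  shows "(x + z) ^ CARD('a) = x ^ CARD('a) + z ^ CARD('a)"
proof -
  let ?q = "CARD('a)"
  have "[:x, 1:] ^ ?q = monom 1 ?q + [:x ^ ?q:]"
  proof (rule poly_eqI_degree_lead_coeff[where A = "range to_ac" and n = ?q])
    show "Polynomial.coeff ([:x, 1:] ^ ?q) ?q = Polynomial.coeff (monom 1 ?q + [:x ^ ?q:]) ?q"
      by (simp add: coeff_linear_power coeff_pCons split: nat.split)
    show "Polynomial.degree (monom 1 ?q + [:x ^ ?q:]) \<le> ?q"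
      by (intro degree_add_le) (simp_all add: degree_monom_le)
  qed (auto simp: card_range_to_ac degree_linear_power poly_monom to_ac_power_card assms)
  then have "poly ([:x, 1:] ^ ?q) z = poly (monom 1 ?q + [:x ^ ?q:]) z"
    by simp
  then show ?thesis
    by (simp add: poly_monom add.commute)
qed

lemma power_card_add:
  fixes x z :: "'a::{finite,field} alg_closure"
  shows "(x + z) ^ CARD('a) = x ^ CARD('a) + z ^ CARD('a)"
proof -
  \<comment> \<open>First one summand is confined to the base field; this case then supplies the
    hypothesis of the auxiliary lemma for two arbitrary summands.\<close>
  have "(to_ac c + x) ^ CARD('a) = to_ac c ^ CARD('a) + x ^ CARD('a)" for c :: 'a and x
    by (rule power_card_add_aux) (simp add: to_ac_power_card flip: to_ac_add)
  then show ?thesis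
    by (intro power_card_add_aux) (simp add: add.commute to_ac_power_card)
qed

text \<open>The polynomial \<open>X ^ q - X\<close> has at most \<open>q\<close> roots, and the
  \<open>q\<close> elements of the base field already exhaust them.\<close>

lemma power_card_fixed_imp_to_ac:
  fixes z :: "'a::{finite,field} alg_closure"
  assumes "z ^ CARD('a) = z"
  shows "z \<in> range (to_ac :: 'a \<Rightarrow> _)"
proof -
  let ?q = "CARD('a)" and ?p = "monom 1 CARD('a) - [:0, 1:] :: 'a alg_closure poly"
  \<comment> \<open>With \<open>q\<close> at least 2 the terms \<open>X ^ q\<close> and
    \<open>X\<close> do not cancel, so the polynomial is nonzero.\<close>
  have "card {0, 1 :: 'a} \<le> ?q"
    by (intro card_mono) auto
  then have q: "?q \<ge> 2"
    by simp
  have "Polynomial.coeff ?p ?q = 1"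
    using q by (simp add: coeff_pCons split: nat.split)
  then have p: "?p \<noteq> 0"
    by (metis coeff_0 zero_neq_one)
  have "Polynomial.degree ?p \<le> ?q"
    using q by (intro degree_diff_le) (simp_all add: degree_monom_le)
  then have "card {x. poly ?p x = 0} \<le> card (range (to_ac :: 'a \<Rightarrow> _))"
    using card_poly_roots_bound[OF p] by (simp add: card_range_to_ac)
  moreover have "range (to_ac :: 'a \<Rightarrow> _) \<subseteq> {x. poly ?p x = 0}"
    by (auto simp: poly_monom to_ac_power_card)
  ultimately have "range (to_ac :: 'a \<Rightarrow> _) = {x. poly ?p x = 0}"
    by (intro card_seteq poly_roots_finite p)
  moreover have "z \<in> {x. poly ?p x = 0}"
    using assms by (simp add: poly_monom)
  ultimately show ?thesis
    by (rule ssubst)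
qed

text \<open>Serves the \<open>q\<close>-power and the \<open>q^2\<close>-power map alike: the
  compatibility with the group law is proved once and used for both.\<close>

locale field_endo =
  fixes h :: "'k::field \<Rightarrow> 'k"
  assumes hom_add: "h (x + y) = h x + h y"
    and hom_mult: "h (x * y) = h x * h y"
    and hom_one: "h 1 = 1"
begin

lemma hom_zero: "h 0 = 0"
  by (metis add_cancel_right_right add_0_right hom_add)

lemma hom_minus: "h (- x) = - h x"
  using hom_add[of x "- x"] by (simp add: hom_zero eq_neg_iff_add_eq_0 add.commute)

lemma hom_diff: "h (x - y) = h x - h y"
  using hom_add[of x "- y"] by (simp add: hom_minus)

lemma hom_eq_0_iff: "h x = 0 \<longleftrightarrow> x = 0"
  using hom_mult[of x "inverse x"] hom_one hom_zero by (cases "x = 0") auto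

lemma hom_eq_iff: "h x = h y \<longleftrightarrow> x = y"
  using hom_eq_0_iff[of "x - y"] by (simp add: hom_diff)

lemma hom_divide: "h (x / y) = h x / h y"
proof (cases "y = 0")
  case False
  then show ?thesis
    using hom_mult[of "x / y" y] by (simp add: hom_eq_0_iff eq_divide_eq)
qed (simp add: hom_zero)

lemma hom_power: "h (x ^ n) = h x ^ n"
  by (induction n) (simp_all add: hom_one hom_mult)

lemma hom_numeral: "h (numeral n) = numeral n"
  by (induction n) (simp_all only: numeral.simps hom_add hom_one)

lemma hom_sum: "h (\<Sum>i\<in>A. f i) = (\<Sum>i\<in>A. h (f i))"
  by (induction A rule: infinite_finite_induct) (simp_all add: hom_zero hom_add)

end

interpretation frob: field_endo "\<lambda>z :: 'a::{finite,field} alg_closure. z ^ CARD('a)"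
  by standard (simp_all add: power_card_add power_mult_distrib)

interpretation frob2: field_endo "\<lambda>z :: 'a::{finite,field} alg_closure. z ^ (CARD('a) ^ 2)"
  by standard (simp_all add: power2_eq_square power_mult power_card_add power_mult_distrib)

text \<open>Frobenius fixes \<open>y ^ 2\<close>, hence sends \<open>y\<close> to \<open>y\<close>
  or \<open>- y\<close>; applied twice it returns \<open>y\<close>.\<close>

lemma Fq2_if_square_in_range_to_ac:
  fixes y :: "'a::{finite,field} alg_closure"
  assumes "y ^ 2 = to_ac c"
  shows "y \<in> Fq2"
proof -
  have "(y ^ CARD('a)) ^ 2 = y ^ 2"
    by (metis assms frob.hom_power to_ac_power_card)
  then have "y ^ CARD('a) = y \<or> y ^ CARD('a) = - y"
    by (simp add: power2_eq_iff)
  then have "(y ^ CARD('a)) ^ CARD('a) = y"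
    using frob.hom_minus[of y] by auto
  then show ?thesis
    by (simp add: Fq2_def power2_eq_square power_mult)
qed

section \<open>The chord-and-tangent law\<close>

lemma Infinity_in_ec_points [simp]: "Infinity \<in> ec_points a b"
  by (simp add: ec_points_def)

lemma Affine_in_ec_points [simp]: "Affine x y \<in> ec_points a b \<longleftrightarrow> y ^ 2 = x ^ 3 + a * x + b"
  by (simp add: ec_points_def)

text \<open>Substitute the line of slope \<open>m\<close> through \<open>(x1, y1)\<close> into the
  cubic and divide by \<open>x - x1\<close>. The second hypothesis says that the quadratic quotient
  vanishes at \<open>x2\<close>, a condition shared by chords and tangents; its roots sum to
  \<open>m ^ 2 - x1\<close>, so the other root is \<open>x3\<close>.\<close>

lemma third_intersection_on_curve:
  fixes m :: "'k::field"
  assumes "y1 ^ 2 = x1 ^ 3 + a * x1 + b"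
    and "x1 ^ 2 + x1 * x2 + x2 ^ 2 + a = m * (2 * y1 + m * (x2 - x1))"
    and "x3 = m ^ 2 - x1 - x2"
  shows "(m * (x1 - x3) - y1) ^ 2 = x3 ^ 3 + a * x3 + b"
proof -
  have "x1 ^ 2 + x1 * x3 + x3 ^ 2 + a - m * (2 * y1 + m * (x3 - x1)) =
     (x1 ^ 2 + x1 * x2 + x2 ^ 2 + a) - m * (2 * y1 + m * (x2 - x1)) + (x3 - x2) * (x3 + x2 + x1 - m ^ 2)"
    by (simp add: power2_eq_square algebra_simps)
  with assms have a: "x1 ^ 2 + x1 * x3 + x3 ^ 2 + a = m * (2 * y1 + m * (x3 - x1))"
    by simp
  have "x3 ^ 3 + a * x3 + b = x1 ^ 3 + a * x1 + b + (x3 - x1) * (x1 ^ 2 + x1 * x3 + x3 ^ 2 + a)"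
    by (simp add: power2_eq_square power3_eq_cube algebra_simps)
  also have "\<dots> = (m * (x1 - x3) - y1) ^ 2"
    unfolding a assms(1)[symmetric] by (simp add: power2_eq_square algebra_simps)
  finally show ?thesis ..
qed

lemma ec_add_closed:
  fixes a b :: "'k::field"
  assumes two: "(2 :: 'k) \<noteq> 0" and P: "P \<in> ec_points a b" and Q: "Q \<in> ec_points a b"
  shows "ec_add a P Q \<in> ec_points a b"
proof (cases P; cases Q)
  fix x1 y1 x2 y2
  assume PQ: "P = Affine x1 y1" "Q = Affine x2 y2"
  with P Q have c1: "y1 ^ 2 = x1 ^ 3 + a * x1 + b" and c2: "y2 ^ 2 = x2 ^ 3 + a * x2 + b"
    by simp_all
  define m where "m = (if x1 = x2 then (3 * x1 ^ 2 + a) / (2 * y1) else (y2 - y1) / (x2 - x1))"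
  show ?thesis
  proof (cases "x1 = x2 \<and> y1 = - y2")
    case False
    have "x1 ^ 2 + x1 * x2 + x2 ^ 2 + a = m * (2 * y1 + m * (x2 - x1))"
    proof (cases "x1 = x2")
      case True
      \<comment> \<open>Points with the same abscissa are equal or opposite; the opposite ones are
        excluded, and then \<open>2 * y1\<close> is a legitimate denominator.\<close>
      with c1 c2 False have "y1 = y2"
        by (metis power2_eq_iff)
      with True False two have "y1 \<noteq> 0"
        by auto
      with True two show ?thesis
        by (simp add: m_def power2_eq_square)
    next
      case False
      then have m: "m * (x2 - x1) = y2 - y1"
        by (simp add: m_def)
      \<comment> \<open>Subtracting the two curve equations gives the slope condition multiplied by
        the nonzero factor \<open>x2 - x1\<close>.\<close>
      have "(x2 - x1) * (x1 ^ 2 + x1 * x2 + x2 ^ 2 + a) = y2 ^ 2 - y1 ^ 2"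
        unfolding c1 c2 by (simp add: power2_eq_square power3_eq_cube algebra_simps)
      also have "\<dots> = (y2 - y1) * (2 * y1 + (y2 - y1))"
        by (simp add: power2_eq_square algebra_simps)
      also have "\<dots> = (x2 - x1) * (m * (2 * y1 + m * (x2 - x1)))"
        by (simp flip: m)
      finally have "(x2 - x1) * (x1 ^ 2 + x1 * x2 + x2 ^ 2 + a) =
        (x2 - x1) * (m * (2 * y1 + m * (x2 - x1)))" .
      with False show ?thesis
        by simp
    qed
    then have "Affine x3 (m * (x1 - x3) - y1) \<in> ec_points a b" if "x3 = m ^ 2 - x1 - x2" for x3
      using third_intersection_on_curve[OF c1 _ that] by simp
    moreover have "ec_add a P Q = (let x3 = m ^ 2 - x1 - x2 in Affine x3 (m * (x1 - x3) - y1))"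
      unfolding PQ ec_add.simps m_def[symmetric] Let_def by (simp only: False if_False)
    ultimately show ?thesis
      by (simp only: Let_def)
  qed (simp add: PQ)
qed (use P Q in auto)

text \<open>A chord has the same slope read from either end. The tangent formula uses only the first
  point, but on the curve two points with equal abscissa are equal or opposite.\<close>

lemma ec_add_commute:
  fixes a b :: "'k::field"
  assumes "P \<in> ec_points a b" and "Q \<in> ec_points a b"
  shows "ec_add a P Q = ec_add a Q P"
proof (cases P; cases Q)
  fix x1 y1 x2 y2
  assume PQ: "P = Affine x1 y1" "Q = Affine x2 y2"
  show ?thesis
  proof (cases "x1 = x2")
    case True
    with assms PQ have "y1 = y2 \<or> y1 = - y2"
      by (metis Affine_in_ec_points power2_eq_iff)
    with True PQ show ?thesis
      by auto
  next
    case False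
    define m where "m = (y2 - y1) / (x2 - x1)"
    have m': "(y1 - y2) / (x1 - x2) = m"
      unfolding m_def by (metis minus_diff_eq minus_divide_divide)
    have "m * (x2 - x1) = y2 - y1"
      using False by (simp add: m_def)
    then have "m * (x1 - (m ^ 2 - x1 - x2)) - y1 = m * (x2 - (m ^ 2 - x2 - x1)) - y2"
      by (simp add: algebra_simps)
    with False PQ m' show ?thesis
      by (auto simp: Let_def simp flip: m_def)
  qed
qed simp_all

text \<open>If doubling an affine point returned its abscissa, the tangent formula would negate the
  ordinate, giving \<open>y = - y\<close>; in that case, however, the sum is
  \<open>Infinity\<close>.\<close>

lemma ec_add_self_eq_imp_Infinity:
  fixes a :: "'k::field"
  assumes two: "(2 :: 'k) \<noteq> 0" and eq: "ec_add a P P = P"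
  shows "P = Infinity"
proof (cases P)
  case (Affine x y)
  then have "y \<noteq> - y" and "y = - y"
    using eq by (auto simp: Let_def split: if_splits)
  then show ?thesis
    by simp
qed simp

context field_endo
begin

lemma map_ec_point_in_ec_points:
  assumes "h a = a" and "h b = b" and "P \<in> ec_points a b"
  shows "map_ec_point h P \<in> ec_points a b"
proof (cases P)
  case (Affine x y)
  have "h y ^ 2 = h (x ^ 3 + a * x + b)"
    using assms Affine by (simp flip: hom_power)
  with Affine assms show ?thesis
    by (simp add: hom_add hom_mult hom_power)
qed simp

text \<open>The addition formulas are rational with fixed coefficients, and injectivity of
  \<open>h\<close> preserves their case distinctions.\<close>

lemma map_ec_point_ec_add:
  assumes "h a = a"
  shows "map_ec_point h (ec_add a P Q) = ec_add a (map_ec_point h P) (map_ec_point h Q)"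
proof (cases P; cases Q)
  fix x1 y1 x2 y2
  assume PQ: "P = Affine x1 y1" "Q = Affine x2 y2"
  have "h y1 = - h y2 \<longleftrightarrow> y1 = - y2"
    by (metis hom_eq_iff hom_minus)
  with assms show ?thesis
    by (simp add: PQ Let_def hom_eq_iff hom_add hom_diff hom_mult hom_divide hom_power hom_numeral)
qed simp_all

end

section \<open>Regular functions on the affine curve\<close>

text \<open>The affine coordinate ring, seen as functions: higher powers of \<open>y\<close> reduce
  by the curve equation, so degree at most one in \<open>y\<close> suffices. Values off the curve
  are irrelevant.\<close>

definition regular_function :: "'k::field \<Rightarrow> 'k \<Rightarrow> ('k \<Rightarrow> 'k \<Rightarrow> 'k) \<Rightarrow> bool" where
  "regular_function a b g \<longleftrightarrow>
     (\<exists>A B. \<forall>x y. y ^ 2 = x ^ 3 + a * x + b \<longrightarrow> g x y = poly A x + y * poly B x)"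

lemma regular_function_poly: "regular_function a b (\<lambda>x y. poly p x)"
  unfolding regular_function_def by (rule exI[of _ p], rule exI[of _ 0]) simp

lemma regular_function_const: "regular_function a b (\<lambda>x y. c)"
  using regular_function_poly[of a b "[:c:]"] by simp

lemma regular_function_x: "regular_function a b (\<lambda>x y. x)"
  using regular_function_poly[of a b "[:0, 1:]"] by simp

lemma regular_function_y: "regular_function a b (\<lambda>x y. y)"
  unfolding regular_function_def by (rule exI[of _ 0], rule exI[of _ 1]) simp

lemma regular_function_add:
  assumes "regular_function a b g" and "regular_function a b h"
  shows "regular_function a b (\<lambda>x y. g x y + h x y)"
proof -
  obtain A B A' B'
    where g: "\<And>x y. y ^ 2 = x ^ 3 + a * x + b \<Longrightarrow> g x y = poly A x + y * poly B x"
      and h: "\<And>x y. y ^ 2 = x ^ 3 + a * x + b \<Longrightarrow> h x y = poly A' x + y * poly B' x"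
    using assms unfolding regular_function_def by metis
  show ?thesis
    unfolding regular_function_def
    by (rule exI[of _ "A + A'"], rule exI[of _ "B + B'"]) (simp add: g h algebra_simps)
qed

lemma regular_function_mult:
  assumes "regular_function a b g" and "regular_function a b h"
  shows "regular_function a b (\<lambda>x y. g x y * h x y)"
proof -
  obtain A B A' B'
    where g: "\<And>x y. y ^ 2 = x ^ 3 + a * x + b \<Longrightarrow> g x y = poly A x + y * poly B x"
      and h: "\<And>x y. y ^ 2 = x ^ 3 + a * x + b \<Longrightarrow> h x y = poly A' x + y * poly B' x"
    using assms unfolding regular_function_def by metis
  have "g x y * h x y = poly (A * A' + [:b, a, 0, 1:] * B * B') x + y * poly (A * B' + B * A') x"
    if "y ^ 2 = x ^ 3 + a * x + b" for x y
  proof -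
    have "poly [:b, a, 0, 1:] x = y ^ 2"
      unfolding that by (simp add: algebra_simps power3_eq_cube)
    then show ?thesis
      unfolding poly_add poly_mult g[OF that] h[OF that]
      by (simp add: algebra_simps power2_eq_square)
  qed
  then show ?thesis
    unfolding regular_function_def by blast
qed

lemma regular_function_diff:
  assumes "regular_function a b g" and "regular_function a b h"
  shows "regular_function a b (\<lambda>x y. g x y - h x y)"
  using regular_function_add[OF assms(1) regular_function_mult[OF regular_function_const[of a b "-1"] assms(2)]]
  by simp

lemma regular_function_power:
  assumes "regular_function a b g"
  shows "regular_function a b (\<lambda>x y. g x y ^ n)"
  by (induction n) (simp_all add: regular_function_const regular_function_mult assms)

lemma regular_function_sum:
  assumes "\<And>i. i \<in> I \<Longrightarrow> regular_function a b (g i)"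
  shows "regular_function a b (\<lambda>x y. \<Sum>i\<in>I. g i x y)"
  using assms
  by (induction I rule: infinite_finite_induct)
    (simp_all add: regular_function_const regular_function_add)

lemmas regular_function_intros =
  regular_function_poly regular_function_const regular_function_x regular_function_y
  regular_function_add regular_function_diff regular_function_mult regular_function_power
  regular_function_sum

lemma regular_function_hom_eval:
  "regular_function a b (\<lambda>x y. hom_eval d c (proj_coords (Affine x y)))"
  unfolding hom_eval_def proj_coords.simps prod.case by (intro regular_function_intros)

section \<open>Finite fibres over the abscissa and zeros of regular functions\<close>

lemma finite_square_roots: "finite {y :: 'k::field. y ^ 2 = w}"
proof (cases "\<exists>z. z ^ 2 = w")
  case True
  then obtain z where "z ^ 2 = w" ..
  then have "{y. y ^ 2 = w} \<subseteq> {z, - z}"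
    by (auto simp: power2_eq_iff)
  then show ?thesis
    by (rule finite_subset) simp
qed simp

lemma finite_ec_points_over_finite:
  fixes a b :: "'k::field"
  assumes "finite S"
  shows "finite {P \<in> ec_points a b. \<exists>x y. P = Affine x y \<and> x \<in> S}"
proof -
  have "{P \<in> ec_points a b. \<exists>x y. P = Affine x y \<and> x \<in> S} =
    (\<Union>x\<in>S. Affine x ` {y. y ^ 2 = x ^ 3 + a * x + b})"
    by auto
  then show ?thesis
    using assms by (simp add: finite_square_roots)
qed

text \<open>If \<open>A + y B\<close> vanishes at infinitely many points, its norm \<open>A^2 - (x^3 + a x + b) B^2\<close> is zero,
  which by the parity of degrees forces \<open>A = B = 0\<close>.\<close>

lemma regular_function_zeros:
  fixes a b :: "'k::field"
  assumes "regular_function a b g" and "infinite Z" and "Z \<subseteq> ec_points a b"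
    and zero: "\<And>x y. Affine x y \<in> Z \<Longrightarrow> g x y = 0"
    and "Affine x y \<in> ec_points a b"
  shows "g x y = 0"
proof -
  obtain A B where g: "\<And>x y. y ^ 2 = x ^ 3 + a * x + b \<Longrightarrow> g x y = poly A x + y * poly B x"
    using assms(1) unfolding regular_function_def by metis
  define f :: "'k poly" where "f = [:b, a, 0, 1:]"
  have poly_f: "poly f x = x ^ 3 + a * x + b" for x
    by (simp add: f_def algebra_simps power3_eq_cube)
  let ?N = "A * A - f * (B * B)"
  have "poly ?N x = 0" if "Affine x y \<in> Z" for x y
  proof -
    have y: "y ^ 2 = x ^ 3 + a * x + b"
      using that assms(3) by auto
    have "poly A x = - (y * poly B x)"
      using zero[OF that] g[OF y] by (simp add: eq_neg_iff_add_eq_0)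
    then show ?thesis
      by (simp add: poly_f flip: y) (simp add: power2_eq_square algebra_simps)
  qed
  then have "Z - {Infinity} \<subseteq> {P \<in> ec_points a b. \<exists>x y. P = Affine x y \<and> x \<in> {x. poly ?N x = 0}}"
    (is "_ \<subseteq> ?R")
    using assms(3) by (auto intro: ec_point.exhaust)
  moreover have "infinite (Z - {Infinity})"
    using \<open>infinite Z\<close> by simp
  ultimately have "infinite ?R"
    by (rule infinite_super)
  \<comment> \<open>Only finitely many points lie above each abscissa, so infinitely many points
    have infinitely many abscissas.\<close>
  then have "infinite {x. poly ?N x = 0}"
    using finite_ec_points_over_finite by blast
  then have N: "A * A = f * (B * B)"
    using poly_roots_finite[of ?N] by auto
  have "B = 0"
  proof (rule ccontr)
    assume "B \<noteq> 0"
    moreover have f: "f \<noteq> 0" "Polynomial.degree f = 3"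
      by (simp_all add: f_def)
    ultimately have "A \<noteq> 0"
      using N by auto
    then have "2 * Polynomial.degree A = 3 + 2 * Polynomial.degree B"
      using arg_cong[OF N, of Polynomial.degree] \<open>B \<noteq> 0\<close> f by (simp add: degree_mult_eq)
    then show False
      by presburger
  qed
  with N have "A = 0"
    by simp
  with \<open>B = 0\<close> show ?thesis
    using assms(5) g by simp
qed

section \<open>The values of the first coordinate at rational points\<close>

text \<open>If the field were finite, the product of all \<open>X - c\<close> plus 1 would have
  positive degree but take the value 1 everywhere.\<close>

lemma infinite_UNIV_alg_closed_field: "infinite (UNIV :: 'k::alg_closed_field set)"
proof
  assume fin: "finite (UNIV :: 'k set)"
  let ?p = "(\<Prod>c\<in>(UNIV :: 'k set). [:- c, 1:]) + 1"
  have deg: "Polynomial.degree (\<Prod>c\<in>(UNIV :: 'k set). [:- c, 1:]) = CARD('k)"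
    by (subst degree_prod_sum_eq) simp_all
  have "CARD('k) > 0"
    using fin by (simp add: card_gt_0_iff)
  then have "Polynomial.degree ?p > 0"
    using deg by (subst degree_add_eq_left) simp_all
  then obtain x where "poly ?p x = 0"
    using alg_closed_imp_poly_has_root by blast
  moreover have "(\<Prod>c\<in>(UNIV :: 'k set). x - c) = 0"
    using fin by (simp add: prod_zero_iff)
  ultimately show False
    by (simp add: poly_prod)
qed

lemma ex_point_over:
  fixes a b x :: "'k::alg_closed_field"
  obtains y where "Affine x y \<in> ec_points a b"
  using nth_root_exists[of 2 "x ^ 3 + a * x + b"] by auto

lemma infinite_ec_points:
  fixes a b :: "'k::alg_closed_field"
  shows "infinite (ec_points a b)"
proof
  assume "finite (ec_points a b)"
  then have "finite ((\<lambda>P. case P of Affine x y \<Rightarrow> x | Infinity \<Rightarrow> 0) ` ec_points a b)"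
    by (rule finite_imageI)
  moreover have "(\<lambda>P. case P of Affine x y \<Rightarrow> x | Infinity \<Rightarrow> 0) ` ec_points a b = UNIV"
  proof -
    have "x \<in> (\<lambda>P. case P of Affine x y \<Rightarrow> x | Infinity \<Rightarrow> 0) ` ec_points a b" for x
    proof -
      obtain y where "Affine x y \<in> ec_points a b"
        by (rule ex_point_over)
      then show ?thesis
        by (rule rev_image_eqI) simp
    qed
    then show ?thesis
      by blast
  qed
  ultimately show False
    using infinite_UNIV_alg_closed_field by metis
qed

section \<open>Values and poles of rational functions\<close>

lemma poly_map_poly_to_ac: "poly (map_poly to_ac p) (to_ac c) = to_ac (poly p c)"
  by (induction p) (simp_all add: map_poly_pCons)

text \<open>Cancelling a common factor \<open>X - c\<close> lowers the degree of the denominator, so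
  the process ends. Being reduced at the single point \<open>c\<close> is all that reading off a
  pole there requires.\<close>

lemma ex_Fract_reduced_at:
  fixes r :: "'k::field poly fract"
  obtains n d where "r = Fract n d" and "d \<noteq> 0" and "poly n c \<noteq> 0 \<or> poly d c \<noteq> 0"
proof -
  obtain n0 d0 where "r = Fract n0 d0" "d0 \<noteq> 0"
    by (cases r) auto
  then have "\<exists>n d. r = Fract n d \<and> d \<noteq> 0 \<and> (poly n c \<noteq> 0 \<or> poly d c \<noteq> 0)"
  proof (induction "Polynomial.degree d0" arbitrary: n0 d0 rule: less_induct)
    case less
    show ?case
    proof (cases "poly n0 c = 0 \<and> poly d0 c = 0")
      case True
      then obtain n1 d1 where n1: "n0 = [:- c, 1:] * n1" and d1: "d0 = [:- c, 1:] * d1"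
        by (meson dvdE poly_eq_0_iff_dvd)
      have "d1 \<noteq> 0"
        using d1 less.prems by auto
      then have "Polynomial.degree d1 < Polynomial.degree d0"
        unfolding d1 by (subst degree_mult_eq) simp_all
      moreover have "r = Fract n1 d1"
        unfolding less.prems(1) n1 d1 by (rule mult_fract_cancel) simp
      ultimately show ?thesis
        using less.hyps \<open>d1 \<noteq> 0\<close> by blast
    qed (use less.prems in blast)
  qed
  then show ?thesis
    using that by blast
qed

lemma rf_pole_Fract_iff:
  assumes "d \<noteq> 0" and "poly n c \<noteq> 0 \<or> poly d c \<noteq> 0"
  shows "rf_pole (Fract n d) c \<longleftrightarrow> poly d c = 0"
proof
  assume d: "poly d c = 0"
  show "rf_pole (Fract n d) c"
    unfolding rf_pole_def
  proof
    assume "\<exists>n' d'. Fract n d = Fract n' d' \<and> poly d' c \<noteq> 0"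
    then obtain n' d' where d': "Fract n d = Fract n' d'" "poly d' c \<noteq> 0"
      by blast
    then have "n * d' = n' * d"
      using assms by (subst (asm) eq_fract) auto
    then have "poly n c * poly d' c = poly n' c * poly d c"
      by (metis poly_mult)
    with d d' assms show False
      by simp
  qed
qed (auto simp: rf_pole_def)

text \<open>Eliminates the projective scaling factor \<open>t\<close>. The resulting equations also
  hold where all three forms vanish, so they can be used at every point of the curve.\<close>

lemma ec_morphism_local:
  assumes "ec_morphism a b a' b' \<phi>" and "P \<in> geom_points a b"
  obtains d cF cG cH
  where "hom_eval d cF (proj_coords P) \<noteq> 0 \<or> hom_eval d cG (proj_coords P) \<noteq> 0 \<or>
      hom_eval d cH (proj_coords P) \<noteq> 0"
    and "\<forall>Q\<in>geom_points a b. \<forall>x y. \<phi> Q = Affine x y \<longrightarrow>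
      hom_eval d cF (proj_coords Q) = hom_eval d cH (proj_coords Q) * x \<and>
      hom_eval d cG (proj_coords Q) = hom_eval d cH (proj_coords Q) * y"
    and "\<forall>Q\<in>geom_points a b. \<phi> Q = Infinity \<longrightarrow>
      hom_eval d cF (proj_coords Q) = 0 \<and> hom_eval d cH (proj_coords Q) = 0"
proof -
  obtain d cF cG cH where
    val_P: "(hom_eval d cF (proj_coords P), hom_eval d cG (proj_coords P),
      hom_eval d cH (proj_coords P)) \<noteq> (0, 0, 0)" and
    val: "\<forall>Q\<in>geom_points a b. (hom_eval d cF (proj_coords Q), hom_eval d cG (proj_coords Q),
          hom_eval d cH (proj_coords Q)) \<noteq> (0, 0, 0) \<longrightarrow>
      (\<exists>t. t \<noteq> 0 \<and> (case proj_coords (\<phi> Q) of (x, y, z) \<Rightarrow>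
        (hom_eval d cF (proj_coords Q), hom_eval d cG (proj_coords Q),
          hom_eval d cH (proj_coords Q)) = (t * x, t * y, t * z)))"
    using bspec[OF conjunct2[OF assms(1)[unfolded ec_morphism_def Let_def]] assms(2)]
    by (elim exE conjE) (rule that)
  have nz: "hom_eval d cF (proj_coords P) \<noteq> 0 \<or> hom_eval d cG (proj_coords P) \<noteq> 0 \<or>
      hom_eval d cH (proj_coords P) \<noteq> 0"
    using val_P by simp
  show ?thesis
  proof (rule that[OF nz]; intro ballI allI impI)
    fix Q x y
    assume "Q \<in> geom_points a b" and "\<phi> Q = Affine x y"
    then show "hom_eval d cF (proj_coords Q) = hom_eval d cH (proj_coords Q) * x \<and>
      hom_eval d cG (proj_coords Q) = hom_eval d cH (proj_coords Q) * y"
      using bspec[OF val, of Q] by auto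
  next
    fix Q
    assume "Q \<in> geom_points a b" and "\<phi> Q = Infinity"
    then show "hom_eval d cF (proj_coords Q) = 0 \<and> hom_eval d cH (proj_coords Q) = 0"
      using bspec[OF val, of Q] by auto
  qed
qed

text \<open>Near the point the map is \<open>[F : G : H]\<close>. The identities \<open>d F = n H\<close> and
  \<open>G^2 d^3 = H^2 (n^3 + a' n d^2 + b' d^3)\<close>, for \<open>u = n / d\<close>, hold at almost all points of the curve,
  hence at the given one; the second excludes that the image is \<open>Infinity\<close> while \<open>d\<close> is nonzero.\<close>

lemma morphism_at_rational_abscissa:
  assumes mor: "ec_morphism a b a' b' \<phi>" and std: "standard_form a b \<phi> u v"
    and P: "Affine (to_ac c) y \<in> geom_points a b"
  shows morphism_at_pole: "rf_pole u c \<Longrightarrow> \<phi> (Affine (to_ac c) y) = Infinity"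
    and morphism_at_non_pole:
      "\<not> rf_pole u c \<Longrightarrow> \<exists>y'. \<phi> (Affine (to_ac c) y) = Affine (to_ac (rf_eval u c)) y'"
proof -
  let ?P = "Affine (to_ac c) y"
  obtain n d where u: "u = Fract n d" and d: "d \<noteq> 0" and nd: "poly n c \<noteq> 0 \<or> poly d c \<noteq> 0"
    by (rule ex_Fract_reduced_at)
  define n' d' where "n' = map_poly to_ac n" and "d' = map_poly to_ac d"
  have "d' \<noteq> 0"
    using d by (simp add: d'_def map_poly_eq_0_iff)
  have u': "rf_ac u = Fract n' d'"
    unfolding u n'_def d'_def using d by (rule rf_ac_Fract)
  obtain e cF cG cH
    where nz: "hom_eval e cF (proj_coords ?P) \<noteq> 0 \<or> hom_eval e cG (proj_coords ?P) \<noteq> 0 \<or>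
        hom_eval e cH (proj_coords ?P) \<noteq> 0"
      and aff: "\<forall>Q\<in>geom_points a b. \<forall>x y. \<phi> Q = Affine x y \<longrightarrow>
        hom_eval e cF (proj_coords Q) = hom_eval e cH (proj_coords Q) * x \<and>
        hom_eval e cG (proj_coords Q) = hom_eval e cH (proj_coords Q) * y"
      and inf: "\<forall>Q\<in>geom_points a b. \<phi> Q = Infinity \<longrightarrow>
        hom_eval e cF (proj_coords Q) = 0 \<and> hom_eval e cH (proj_coords Q) = 0"
    by (rule ec_morphism_local[OF mor P]) (rule that)
  define F G H
    where "F x y = hom_eval e cF (proj_coords (Affine x y))"
      and "G x y = hom_eval e cG (proj_coords (Affine x y))"
      and "H x y = hom_eval e cH (proj_coords (Affine x y))" for x y
  have reg: "regular_function (to_ac a) (to_ac b) F" "regular_function (to_ac a) (to_ac b) G"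
    "regular_function (to_ac a) (to_ac b) H"
    unfolding F_def G_def H_def by (rule regular_function_hom_eval)+
  \<comment> \<open>The points at which \<open>n' / d'\<close> visibly computes the abscissa of the
    image. Only finitely many points are missed: the exceptions in \<open>standard_form\<close> and
    the points above roots of \<open>d'\<close>.\<close>
  define Z where "Z = {Q \<in> geom_points a b. \<exists>x y y'. Q = Affine x y \<and> poly d' x \<noteq> 0 \<and>
    \<phi> Q = Affine (poly n' x / poly d' x) y'}"
  have "geom_points a b \<subseteq> Z \<union> {Q \<in> geom_points a b. \<not> (\<exists>x y. Q = Affine x y \<and>
       \<not> rf_pole (rf_ac u) x \<and> \<not> rf_pole (rf_ac v) x \<and>
       \<phi> Q = Affine (rf_eval (rf_ac u) x) (y * rf_eval (rf_ac v) x))} \<union>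
    {Q \<in> geom_points a b. \<exists>x y. Q = Affine x y \<and> x \<in> {x. poly d' x = 0}}"
    (is "_ \<subseteq> Z \<union> ?S \<union> ?D")
  proof
    fix Q
    assume Q: "Q \<in> geom_points a b"
    show "Q \<in> Z \<union> ?S \<union> ?D"
    proof (cases "Q \<in> ?S \<union> ?D")
      case False
      then obtain x y where xy: "Q = Affine x y"
        "\<phi> Q = Affine (rf_eval (rf_ac u) x) (y * rf_eval (rf_ac v) x)"
        using Q by blast
      moreover from xy False Q have "poly d' x \<noteq> 0"
        by blast
      ultimately have "Q \<in> Z"
        using Q unfolding Z_def u' by (simp add: rf_eval_Fract)
      then show ?thesis
        by blast
    qed blast
  qed
  moreover have "finite ?S"
    using std unfolding standard_form_def .
  moreover have "finite ?D"
    using poly_roots_finite[OF \<open>d' \<noteq> 0\<close>] by (rule finite_ec_points_over_finite)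
  ultimately have Z: "infinite Z"
    using infinite_ec_points[of "to_ac a" "to_ac b"] by (meson finite_UnI finite_subset)
  have Z_sub: "Z \<subseteq> geom_points a b"
    unfolding Z_def by blast
  have on_Z: "poly d' x * F x y - poly n' x * H x y = 0 \<and>
    G x y ^ 2 * poly d' x ^ 3 - H x y ^ 2 * (poly n' x ^ 3 + to_ac a' * poly n' x * poly d' x ^ 2 +
      to_ac b' * poly d' x ^ 3) = 0"
    if "Affine x y \<in> Z" for x y
  proof -
    from that obtain w where d'x: "poly d' x \<noteq> 0"
      and w: "\<phi> (Affine x y) = Affine (poly n' x / poly d' x) w"
      unfolding Z_def by blast
    have Q: "Affine x y \<in> geom_points a b"
      using that Z_sub by blast
    define t where "t = poly n' x / poly d' x"
    have n'x: "poly n' x = t * poly d' x"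
      using d'x by (simp add: t_def)
    have F: "F x y = H x y * t" and G: "G x y = H x y * w"
      unfolding F_def G_def H_def t_def using aff Q w by blast+
    have "\<phi> (Affine x y) \<in> geom_points a' b'"
      using mor Q unfolding ec_morphism_def by blast
    then have w2: "w ^ 2 = t ^ 3 + to_ac a' * t + to_ac b'"
      unfolding w t_def by simp
    have "G x y ^ 2 * poly d' x ^ 3 = H x y ^ 2 * (w ^ 2 * poly d' x ^ 3)"
      unfolding G by (simp add: power_mult_distrib)
    also have "w ^ 2 * poly d' x ^ 3 = poly n' x ^ 3 + to_ac a' * poly n' x * poly d' x ^ 2 +
      to_ac b' * poly d' x ^ 3"
      unfolding w2 n'x by (simp add: algebra_simps power2_eq_square power3_eq_cube)
    finally show ?thesis
      unfolding F n'x by simp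
  qed
  \<comment> \<open>A regular function vanishing on the infinite set \<open>Z\<close> vanishes on
    the whole affine curve, in particular above \<open>c\<close>.\<close>
  have dF: "poly d' (to_ac c) * F (to_ac c) y - poly n' (to_ac c) * H (to_ac c) y = 0"
    by (rule regular_function_zeros[OF _ Z Z_sub _ P])
      (use on_Z in \<open>auto intro!: regular_function_intros reg\<close>)
  have dG: "G (to_ac c) y ^ 2 * poly d' (to_ac c) ^ 3 - H (to_ac c) y ^ 2 *
    (poly n' (to_ac c) ^ 3 + to_ac a' * poly n' (to_ac c) * poly d' (to_ac c) ^ 2 +
      to_ac b' * poly d' (to_ac c) ^ 3) = 0"
    by (rule regular_function_zeros[OF _ Z Z_sub _ P])
      (use on_Z in \<open>auto intro!: regular_function_intros reg\<close>)
  have ev: "poly d' (to_ac c) = to_ac (poly d c)" "poly n' (to_ac c) = to_ac (poly n c)"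
    by (simp_all add: d'_def n'_def poly_map_poly_to_ac)
  have infinity: "poly d c = 0" if "\<phi> ?P = Infinity"
  proof -
    have "F (to_ac c) y = 0" "H (to_ac c) y = 0"
      unfolding F_def H_def using inf P that by blast+
    moreover from this nz have "G (to_ac c) y \<noteq> 0"
      unfolding F_def G_def H_def by blast
    ultimately show ?thesis
      using dG by (simp add: ev)
  qed
  have affine: "to_ac (poly d c) * x = to_ac (poly n c)" if "\<phi> ?P = Affine x w" for x w
  proof -
    have FG: "F (to_ac c) y = H (to_ac c) y * x" "G (to_ac c) y = H (to_ac c) y * w"
      unfolding F_def G_def H_def using aff P that by blast+
    moreover have "F (to_ac c) y \<noteq> 0 \<or> G (to_ac c) y \<noteq> 0 \<or> H (to_ac c) y \<noteq> 0"
      using nz unfolding F_def G_def H_def .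
    \<comment> \<open>At an affine image \<open>F\<close> and \<open>G\<close> are multiples of
      \<open>H\<close>, so \<open>H\<close> cannot vanish and may be cancelled.\<close>
    ultimately have "H (to_ac c) y \<noteq> 0"
      by auto
    moreover have "H (to_ac c) y * (to_ac (poly d c) * x) = H (to_ac c) y * to_ac (poly n c)"
      using dF unfolding FG ev by (simp add: algebra_simps)
    ultimately show ?thesis
      by simp
  qed
  show "\<phi> ?P = Infinity" if "rf_pole u c"
  proof (cases "\<phi> ?P")
    case (Affine x w)
    \<comment> \<open>An affine image would now force \<open>n\<close> to vanish at \<open>c\<close>
      as well, against the choice of a fraction reduced there.\<close>
    have "poly d c = 0"
      using that d nd by (simp add: u rf_pole_Fract_iff)
    with affine[OF Affine] nd show ?thesis
      by simp
  qed
  show "\<exists>y'. \<phi> ?P = Affine (to_ac (rf_eval u c)) y'" if "\<not> rf_pole u c"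
  proof -
    have dc: "poly d c \<noteq> 0"
      using that d nd by (simp add: u rf_pole_Fract_iff)
    show ?thesis
    proof (cases "\<phi> ?P")
      case Infinity
      with infinity dc show ?thesis
        by simp
    next
      case (Affine x w)
      have "x = to_ac (rf_eval u c)"
        using affine[OF Affine] dc by (simp add: u rf_eval_Fract eq_divide_eq mult.commute)
      with Affine show ?thesis
        by blast
    qed
  qed
qed

section \<open>Frobenius and the kernel\<close>

abbreviation frobenius :: "'a::{finite,field} alg_closure ec_point \<Rightarrow> 'a alg_closure ec_point" where
  "frobenius \<equiv> map_ec_point (\<lambda>z. z ^ CARD('a))"

text \<open>Frobenius is a field endomorphism fixing the coefficients, which come from the base
  field.\<close>

lemma hom_eval_frobenius:
  fixes P :: "'a::{finite,field} alg_closure ec_point"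
  shows "hom_eval d c (proj_coords (frobenius P)) = hom_eval d c (proj_coords P) ^ CARD('a)"
proof (cases P)
  case Infinity
  have "(hom_eval d c (proj_coords P)) ^ CARD('a) =
    (\<Sum>i\<le>d. \<Sum>j\<le>d - i. (to_ac (c i j) * 0 ^ i * 1 ^ j * 0 ^ (d - i - j)) ^ CARD('a))"
    by (simp only: Infinity hom_eval_def proj_coords.simps prod.case frob.hom_sum)
  also have "\<dots> = hom_eval d c (proj_coords P)"
    by (simp only: Infinity hom_eval_def proj_coords.simps prod.case frob.hom_mult frob.hom_zero
        frob.hom_one to_ac_power_card frob.hom_power)
  finally show ?thesis
    by (simp add: Infinity)
next
  case (Affine x y)
  show ?thesis
    by (simp only: Affine hom_eval_def ec_point.map proj_coords.simps prod.case frob.hom_sum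
        frob.hom_mult frob.hom_one to_ac_power_card frob.hom_power)
qed

lemma to_ac_power_card_sq: "to_ac (c :: 'a::{finite,field}) ^ (CARD('a) ^ 2) = to_ac c"
  by (simp only: power2_eq_square power_mult to_ac_power_card)

lemma frobenius_in_geom_points:
  fixes a b :: "'a::{finite,field}"
  assumes "P \<in> geom_points a b"
  shows "frobenius P \<in> geom_points a b"
  using frob.map_ec_point_in_ec_points[OF to_ac_power_card to_ac_power_card assms] .

text \<open>Passing from \<open>P\<close> to its Frobenius image raises the local forms to their
  \<open>q\<close>-th powers, so \<open>F\<close> and \<open>H\<close> stay zero and
  \<open>G\<close> stays nonzero; an affine image would make \<open>G\<close> a multiple of
  \<open>H\<close>.\<close>

lemma morphism_frobenius_eq_Infinity:
  fixes a b :: "'a::{finite,field}"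
  assumes "ec_morphism a b a' b' \<phi>" and P: "P \<in> geom_points a b" and "\<phi> P = Infinity"
  shows "\<phi> (frobenius P) = Infinity"
proof (rule ccontr)
  assume "\<phi> (frobenius P) \<noteq> Infinity"
  then obtain x y where xy: "\<phi> (frobenius P) = Affine x y"
    by (cases "\<phi> (frobenius P)") auto
  obtain d cF cG cH
    where nz: "hom_eval d cF (proj_coords P) \<noteq> 0 \<or> hom_eval d cG (proj_coords P) \<noteq> 0 \<or>
        hom_eval d cH (proj_coords P) \<noteq> 0"
      and aff: "\<forall>Q\<in>geom_points a b. \<forall>x y. \<phi> Q = Affine x y \<longrightarrow>
        hom_eval d cF (proj_coords Q) = hom_eval d cH (proj_coords Q) * x \<and>
        hom_eval d cG (proj_coords Q) = hom_eval d cH (proj_coords Q) * y"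
      and inf: "\<forall>Q\<in>geom_points a b. \<phi> Q = Infinity \<longrightarrow>
        hom_eval d cF (proj_coords Q) = 0 \<and> hom_eval d cH (proj_coords Q) = 0"
    by (rule ec_morphism_local[OF assms(1) P]) (rule that)
  have FH: "hom_eval d cF (proj_coords P) = 0" "hom_eval d cH (proj_coords P) = 0"
    using inf assms by blast+
  have "hom_eval d cG (proj_coords P) ^ CARD('a) = hom_eval d cH (proj_coords P) ^ CARD('a) * y"
    using aff frobenius_in_geom_points[OF P] xy by (metis hom_eval_frobenius)
  with FH have "hom_eval d cG (proj_coords P) = 0"
    by (simp add: power_0_left)
  with nz FH show False
    by blast
qed

lemma frobenius_frobenius_Fq2:
  fixes x y :: "'a::{finite,field} alg_closure"
  assumes "x \<in> Fq2" and "y \<in> Fq2"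
  shows "frobenius (frobenius (Affine x y)) = Affine x y"
  using assms by (simp add: Fq2_def power2_eq_square power_mult)

lemma to_ac_in_Fq2: "to_ac (c :: 'a::{finite,field}) \<in> Fq2"
  by (simp only: Fq2_def mem_Collect_eq to_ac_power_card_sq)

lemma two_neq_zero_alg_closure:
  assumes "CHAR('a::field) \<noteq> 2"
  shows "(2 :: 'a alg_closure) \<noteq> 0"
proof
  assume "(2 :: 'a alg_closure) = 0"
  then have "to_ac (of_nat 2 :: 'a) = 0"
    by simp
  then have "of_nat 2 = (0 :: 'a)"
    by (simp only: to_ac_eq_0_iff)
  then have "CHAR('a) dvd 2"
    by (simp only: of_nat_eq_0_iff_char_dvd)
  then have "CHAR('a) = 1 \<or> CHAR('a) = 2"
    using two_is_prime_nat prime_nat_iff by blast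
  with assms show False
    by simp
qed

lemma ec_add_Affine_eq_Infinity:
  assumes "ec_add a (Affine x1 y1) Q = Infinity"
  shows "Q = Affine x1 (- y1)"
  using assms by (cases Q) (auto simp: Let_def split: if_splits)

lemma Fq2_ordinate:
  fixes a b :: "'a::{finite,field}"
  assumes "Affine (to_ac c) y \<in> geom_points a b"
  shows "y \<in> Fq2"
  using assms by (intro Fq2_if_square_in_range_to_ac[of y "c ^ 3 + a * c + b"]) simp

lemma isogeny_Infinity:
  assumes "(2 :: 'a::field alg_closure) \<noteq> 0" and "isogeny (a :: 'a) b a' b' \<phi>"
  shows "\<phi> Infinity = Infinity"
proof -
  have "\<phi> (ec_add (to_ac a) Infinity Infinity) = ec_add (to_ac a') (\<phi> Infinity) (\<phi> Infinity)"
    using assms(2) unfolding isogeny_def by (meson Infinity_in_ec_points)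
  then have "ec_add (to_ac a') (\<phi> Infinity) (\<phi> Infinity) = \<phi> Infinity"
    by simp
  with assms(1) show ?thesis
    by (rule ec_add_self_eq_imp_Infinity)
qed

section \<open>Rational poles, kernel points over \<open>Fq2\<close>, and injectivity\<close>

lemma no_pole_imp_trivial_kernel:
  fixes a b a' b' :: "'a::{finite,field}"
  assumes two: "(2 :: 'a alg_closure) \<noteq> 0"
    and iso: "isogeny a b a' b' \<phi>" and std: "standard_form a b \<phi> u v"
    and no_pole: "\<And>c. \<not> rf_pole u c"
  shows "Fq2_rational (isogeny_kernel a b \<phi>) = {Infinity}"
proof -
  have mor: "ec_morphism a b a' b' \<phi>"
    and hom: "\<And>P Q. P \<in> geom_points a b \<Longrightarrow> Q \<in> geom_points a b \<Longrightarrow>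
      \<phi> (ec_add (to_ac a) P Q) = ec_add (to_ac a') (\<phi> P) (\<phi> Q)"
    using iso unfolding isogeny_def by blast+
  \<comment> \<open>The abscissa of such a point lies in the base field and is not a pole, so the
    image is affine.\<close>
  have rational: False
    if P: "Affine x y \<in> geom_points a b" "\<phi> (Affine x y) = Infinity" and x: "x ^ CARD('a) = x"
    for x y
  proof -
    obtain c :: 'a where "x = to_ac c"
      using power_card_fixed_imp_to_ac[OF x] by blast
    then show False
      using morphism_at_non_pole[OF mor std _ no_pole] P by fastforce
  qed
  have "P = Infinity" if ker: "P \<in> Fq2_rational (isogeny_kernel a b \<phi>)" for P
  proof (rule ccontr)
    assume "P \<noteq> Infinity"
    then obtain x y where xy: "P = Affine x y" "x \<in> Fq2" "y \<in> Fq2"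
      using ker unfolding Fq2_rational_def by blast
    have P: "P \<in> geom_points a b" "\<phi> P = Infinity"
      using ker unfolding Fq2_rational_def isogeny_kernel_def by blast+
    \<comment> \<open>The trace of \<open>P\<close> from \<open>Fq2\<close> to the base field;
      Frobenius swaps its two summands.\<close>
    define Q where "Q = ec_add (to_ac a) P (frobenius P)"
    note FP = frobenius_in_geom_points[OF P(1)]
    have Q: "Q \<in> geom_points a b"
      unfolding Q_def using two P(1) FP by (rule ec_add_closed)
    have "\<phi> Q = ec_add (to_ac a') (\<phi> P) (\<phi> (frobenius P))"
      unfolding Q_def using P(1) FP by (rule hom)
    then have \<phi>Q: "\<phi> Q = Infinity"
      using P(2) morphism_frobenius_eq_Infinity[OF mor P] by simp
    have "frobenius Q = ec_add (to_ac a) (frobenius P) (frobenius (frobenius P))"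
      unfolding Q_def by (rule frob.map_ec_point_ec_add[OF to_ac_power_card])
    also have "frobenius (frobenius P) = P"
      unfolding xy(1) using xy(2,3) by (rule frobenius_frobenius_Fq2)
    also have "ec_add (to_ac a) (frobenius P) P = Q"
      unfolding Q_def using FP P(1) by (rule ec_add_commute)
    finally have FQ: "frobenius Q = Q" .
    show False
    proof (cases Q)
      case Infinity
      \<comment> \<open>When the trace is zero, Frobenius negates \<open>P\<close> and thus fixes
        its abscissa.\<close>
      then have "frobenius P = Affine x (- y)"
        unfolding Q_def xy(1) by (rule ec_add_Affine_eq_Infinity)
      then show False
        using P xy(1) rational[of x y] by simp
    next
      case (Affine x' y')
      then show False
        using Q \<phi>Q FQ rational[of x' y'] by simp
    qed
  qed
  moreover have "Infinity \<in> Fq2_rational (isogeny_kernel a b \<phi>)"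
    using isogeny_Infinity[OF two iso] by (simp add: Fq2_rational_def isogeny_kernel_def)
  ultimately show ?thesis
    by blast
qed

text \<open>Coordinates in \<open>Fq2\<close> are those fixed by the \<open>q^2\<close>-power map,
  which commutes with addition.\<close>

lemma ec_add_in_Fq2:
  fixes a :: "'a::{finite,field}"
  assumes "x1 \<in> Fq2" "y1 \<in> Fq2" "x2 \<in> Fq2" "y2 \<in> Fq2"
  shows "ec_add (to_ac a) (Affine x1 y1) (Affine x2 y2) = Infinity \<or>
    (\<exists>x\<in>Fq2. \<exists>y\<in>Fq2. ec_add (to_ac a) (Affine x1 y1) (Affine x2 y2) = Affine x y)"
proof -
  let ?R = "ec_add (to_ac a) (Affine x1 y1) (Affine x2 y2)"
  have fixed: "map_ec_point (\<lambda>z. z ^ (CARD('a) ^ 2)) (Affine x y) = Affine x y"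
    if "x \<in> Fq2" "y \<in> Fq2" for x y :: "'a alg_closure"
    using that by (simp add: Fq2_def)
  have "map_ec_point (\<lambda>z. z ^ (CARD('a) ^ 2)) ?R = ?R"
    using frob2.map_ec_point_ec_add[OF to_ac_power_card_sq, of a "Affine x1 y1" "Affine x2 y2"]
    unfolding fixed[OF assms(1,2)] fixed[OF assms(3,4)] .
  then show ?thesis
    by (cases ?R) (simp_all add: Fq2_def)
qed

lemma trivial_kernel_imp_permutation:
  fixes a b a' b' :: "'a::{finite,field}"
  assumes two: "(2 :: 'a alg_closure) \<noteq> 0"
    and iso: "isogeny a b a' b' \<phi>" and std: "standard_form a b \<phi> u v"
    and ker: "Fq2_rational (isogeny_kernel a b \<phi>) = {Infinity}"
  shows "permutation_rf u"
proof -
  have mor: "ec_morphism a b a' b' \<phi>"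
    and hom: "\<And>P Q. P \<in> geom_points a b \<Longrightarrow> Q \<in> geom_points a b \<Longrightarrow>
      \<phi> (ec_add (to_ac a) P Q) = ec_add (to_ac a') (\<phi> P) (\<phi> Q)"
    using iso unfolding isogeny_def by blast+
  have no_pole: "\<not> rf_pole u c" for c
  proof
    assume "rf_pole u c"
    obtain y where P: "Affine (to_ac c) y \<in> geom_points a b"
      by (rule ex_point_over)
    have "\<phi> (Affine (to_ac c) y) = Infinity"
      using mor std P \<open>rf_pole u c\<close> by (rule morphism_at_pole)
    then have "Affine (to_ac c) y \<in> Fq2_rational (isogeny_kernel a b \<phi>)"
      using P Fq2_ordinate[OF P] to_ac_in_Fq2[of c]
      unfolding Fq2_rational_def isogeny_kernel_def by blast
    then show False
      using ker by blast
  qed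
  \<comment> \<open>Opposite images make the sum of the two points a kernel point over
    \<open>Fq2\<close>, hence \<open>Infinity\<close>; so the points are opposite and share their
    abscissa.\<close>
  have eq: "c1 = c2"
    if "Affine (to_ac c1) y1 \<in> geom_points a b" "Affine (to_ac c2) y2 \<in> geom_points a b"
      "\<phi> (Affine (to_ac c1) y1) = Affine w z" "\<phi> (Affine (to_ac c2) y2) = Affine w (- z)"
    for c1 c2 y1 y2 w z
  proof -
    let ?R = "ec_add (to_ac a) (Affine (to_ac c1) y1) (Affine (to_ac c2) y2)"
    have "\<phi> ?R = Infinity"
      unfolding hom[OF that(1,2)] that(3,4) by simp
    moreover have "?R \<in> geom_points a b"
      using two that(1,2) by (rule ec_add_closed)
    moreover have "?R = Infinity \<or> (\<exists>x\<in>Fq2. \<exists>y\<in>Fq2. ?R = Affine x y)"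
      using that(1,2) by (intro ec_add_in_Fq2 to_ac_in_Fq2 Fq2_ordinate)
    ultimately have "?R \<in> Fq2_rational (isogeny_kernel a b \<phi>)"
      unfolding Fq2_rational_def isogeny_kernel_def by blast
    then have "?R = Infinity"
      using ker by blast
    then have "Affine (to_ac c2) y2 = Affine (to_ac c1) (- y1)"
      by (rule ec_add_Affine_eq_Infinity)
    then show ?thesis
      by simp
  qed
  have inj: "inj (rf_eval u)"
  proof (rule injI)
    fix c1 c2
    assume u12: "rf_eval u c1 = rf_eval u c2"
    obtain y1 where P1: "Affine (to_ac c1) y1 \<in> geom_points a b"
      by (rule ex_point_over)
    obtain y2 where P2: "Affine (to_ac c2) y2 \<in> geom_points a b"
      by (rule ex_point_over)
    obtain z1 where \<phi>1: "\<phi> (Affine (to_ac c1) y1) = Affine (to_ac (rf_eval u c1)) z1"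
      using morphism_at_non_pole[OF mor std P1 no_pole] by blast
    obtain z2 where \<phi>2: "\<phi> (Affine (to_ac c2) y2) = Affine (to_ac (rf_eval u c1)) z2"
      using morphism_at_non_pole[OF mor std P2 no_pole] unfolding u12 by blast
    have "\<phi> (Affine (to_ac c1) y1) \<in> geom_points a' b'" "\<phi> (Affine (to_ac c2) y2) \<in> geom_points a' b'"
      using mor P1 P2 unfolding ec_morphism_def by blast+
    then have "z2 ^ 2 = z1 ^ 2"
      unfolding \<phi>1 \<phi>2 by simp
    then consider "z2 = - z1" | "z2 = z1"
      by (auto simp: power2_eq_iff)
    then show "c1 = c2"
    proof cases
      case 1
      then show ?thesis
        using eq[OF P1 P2 \<phi>1] \<phi>2 by simp
    next
      case 2
      \<comment> \<open>Equal images are reduced to opposite ones by reflecting the second point,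
        which negates its image.\<close>
      have P2': "Affine (to_ac c2) (- y2) \<in> geom_points a b"
        using P2 by simp
      have "ec_add (to_ac a') (\<phi> (Affine (to_ac c2) y2)) (\<phi> (Affine (to_ac c2) (- y2))) = Infinity"
        using isogeny_Infinity[OF two iso] by (simp flip: hom[OF P2 P2'])
      then have "\<phi> (Affine (to_ac c2) (- y2)) = Affine (to_ac (rf_eval u c1)) (- z2)"
        unfolding \<phi>2 by (rule ec_add_Affine_eq_Infinity)
      then show ?thesis
        using eq[OF P1 P2' \<phi>1] 2 by simp
    qed
  qed
  \<comment> \<open>Surjectivity comes from finiteness of the base field.\<close>
  then have "bij (rf_eval u)"
    by (simp add: bij_def finite_UNIV_inj_surj)
  with no_pole show ?thesis
    unfolding permutation_rf_def bij_iff by blast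
qed

theorem theorem2p1:
  fixes a b a' b' :: "'a::{finite,field}"
    and \<phi> :: "'a alg_closure ec_point \<Rightarrow> 'a alg_closure ec_point"
    and u v :: "'a poly fract"
    and l :: nat
  assumes "CHAR('a) \<noteq> 2" and "CHAR('a) \<noteq> 3"
    and "elliptic_curve a b" and "elliptic_curve a' b'"
    and "isogeny a b a' b' \<phi>"
    and "has_isogeny_degree a b a' b' \<phi> l" and "prime l"
    and "standard_form a b \<phi> u v"
  shows "((\<forall>c. \<not> rf_pole u c) \<longleftrightarrow> Fq2_rational (isogeny_kernel a b \<phi>) = {Infinity}) \<and>
         (Fq2_rational (isogeny_kernel a b \<phi>) = {Infinity} \<longleftrightarrow> permutation_rf u)"
proof -
  note two = two_neq_zero_alg_closure[OF assms(1)]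
  have "Fq2_rational (isogeny_kernel a b \<phi>) = {Infinity}" if "\<forall>c. \<not> rf_pole u c"
    using no_pole_imp_trivial_kernel[OF two assms(5,8)] that by blast
  moreover have "permutation_rf u" if "Fq2_rational (isogeny_kernel a b \<phi>) = {Infinity}"
    using two assms(5,8) that by (rule trivial_kernel_imp_permutation)
  moreover have "\<forall>c. \<not> rf_pole u c" if "permutation_rf u"
    using that unfolding permutation_rf_def by blast
  ultimately show ?thesis
    by blast
qed

end
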